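(* Let $m\ge 1$, let $G\subset\mathbb{R}^{n_0}\times\mathbb{R}^{n_1}\times\dots\times\mathbb{R}^{n_m}$ be nonempty, and for $i\in\{1,\dots,m\}$ let $F_i\subset\mathbb{R}^{n_0}\times\mathbb{R}^{n_i}$ and let $g_i$ be the real-valued objective function of player $i$ (with notation and domains as in the context). Assume that $g^N(x)>-\infty$ for all $x\in\pi_0(\hat F\cap G)$. Consider the problem $$\delta^N=\inf_{x,y,w}\ \sum_{i=1}^m g_i(x,y_i)-w$$ over $(x,y,w)$ with $x\in\mathbb{R}^{n_0}$, $y\in\prod_{i=1}^m\mathbb{R}^{n_i}$, $w\in\mathbb{R}$, subject to $$(x,y)\in G,\qquad (x,y)\in\hat F,\qquad w\le\sum_{i=1}^m g_i(x,y_i')\quad\forall y'\in\pi_{-0}(\hat F\cap G).$$ Then a point $(x^*,y^* )$ is a normalized Nash equilibrium (NNE) if and only if there exists $w^*\in\mathbb{R}$ such that $(x^*,y^*,w^* )$ is a solution of this problem with $\delta^N=0$.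
   Context: Write $y=(y_1,\dots,y_m)$ with $y_i\in\mathbb{R}^{n_i}$. Define $$\hat F=\{(x,y_1,\dots,y_m) : (x,y_i)\in F_i\ \ \forall i\in\{1,\dots,m\}\}.$$ The projections are $\pi_0(x,y_1,\dots,y_m)=x$ and $\pi_{-0}(x,y_1,\dots,y_m)=(y_1,\dots,y_m)$. Each $g_i$ is a real-valued function $g_i:D_i\to\mathbb{R}$, where $D_i\subset\mathbb{R}^{n_0}\times\mathbb{R}^{n_i}$ contains $F_i$ and all points $(x,y_i')$ with $x\in\pi_0(\hat F\cap G)$ and $y'\in\pi_{-0}(\hat F\cap G)$. For $x\in\pi_0(\hat F\cap G)$ define $$g^N(x)=\inf_{y'}\Big\{\sum_{i=1}^m g_i(x,y_i') : y'\in\pi_{-0}(\hat F\cap G)\Big\}.$$ A point $(x^*,y^* )$ is a normalized Nash equilibrium (NNE) if $(x^*,y^* )\in\hat F\cap G$ and $\sum_i g_i(x^*,y_i^* )\le\sum_i g_i(x^*,y_i')$ for all $(x',y')\in\hat F\cap G$. A "solution" of an optimization problem is a feasible point at which the infimum is attained. The infimum over an empty feasible set is $+\infty$. *)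

theory Defs
  imports
    "Jordan_Normal_Form.Matrix"
    "HOL-Library.FuncSet"
    "HOL-Library.Extended_Real"
begin

text \<open>
  A point of \<open>\<real>\<^sup>k\<close> is a vector in \<open>carrier_vec k\<close>. The dimensions \<open>n 0, n 1, \<dots>, n m\<close> vary with the
  index, and the tuple \<open>(y\<^sub>1, \<dots>, y\<^sub>m)\<close> is an extensional function on \<open>{1..m}\<close>, so that distinct
  functions represent distinct tuples. The projections \<open>\<pi>\<^sub>0\<close> and \<open>\<pi>\<^sub>-\<^sub>0\<close> of a pair \<open>(x, y)\<close> are
  \<open>fst\<close> and \<open>snd\<close>.
\<close>

definition strategy_tuples :: "nat \<Rightarrow> (nat \<Rightarrow> nat) \<Rightarrow> (nat \<Rightarrow> real vec) set" where
  "strategy_tuples m n = (\<Pi>\<^sub>E i\<in>{1..m}. carrier_vec (n i))"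

definition F_hat ::
  "nat \<Rightarrow> (nat \<Rightarrow> nat) \<Rightarrow> (nat \<Rightarrow> (real vec \<times> real vec) set) \<Rightarrow> (real vec \<times> (nat \<Rightarrow> real vec)) set"
  where
  "F_hat m n F = {(x, y). x \<in> carrier_vec (n 0) \<and> y \<in> strategy_tuples m n \<and>
     (\<forall>i\<in>{1..m}. (x, y i) \<in> F i)}"

definition total_cost ::
  "nat \<Rightarrow> (nat \<Rightarrow> real vec \<times> real vec \<Rightarrow> real) \<Rightarrow> real vec \<Rightarrow> (nat \<Rightarrow> real vec) \<Rightarrow> real" where
  "total_cost m g x y = (\<Sum>i = 1..m. g i (x, y i))"

definition opt_value :: "'a set \<Rightarrow> ('a \<Rightarrow> real) \<Rightarrow> ereal" where
  "opt_value S f = (INF z\<in>S. ereal (f z))"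

definition is_solution :: "'a set \<Rightarrow> ('a \<Rightarrow> real) \<Rightarrow> 'a \<Rightarrow> bool" where
  "is_solution S f z \<longleftrightarrow> z \<in> S \<and> ereal (f z) = opt_value S f"

definition g_N ::
  "nat \<Rightarrow> (nat \<Rightarrow> nat) \<Rightarrow> (nat \<Rightarrow> (real vec \<times> real vec) set) \<Rightarrow> (real vec \<times> (nat \<Rightarrow> real vec)) set
   \<Rightarrow> (nat \<Rightarrow> real vec \<times> real vec \<Rightarrow> real) \<Rightarrow> real vec \<Rightarrow> ereal" where
  "g_N m n F G g x = opt_value (snd ` (F_hat m n F \<inter> G)) (\<lambda>y'. total_cost m g x y')"

definition NNE ::
  "nat \<Rightarrow> (nat \<Rightarrow> nat) \<Rightarrow> (nat \<Rightarrow> (real vec \<times> real vec) set) \<Rightarrow> (real vec \<times> (nat \<Rightarrow> real vec)) set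
   \<Rightarrow> (nat \<Rightarrow> real vec \<times> real vec \<Rightarrow> real) \<Rightarrow> real vec \<times> (nat \<Rightarrow> real vec) \<Rightarrow> bool" where
  "NNE m n F G g = (\<lambda>(xs, ys). (xs, ys) \<in> F_hat m n F \<inter> G \<and>
     (\<forall>(x', y')\<in>F_hat m n F \<inter> G. total_cost m g xs ys \<le> total_cost m g xs y'))"

definition feasible_N ::
  "nat \<Rightarrow> (nat \<Rightarrow> nat) \<Rightarrow> (nat \<Rightarrow> (real vec \<times> real vec) set) \<Rightarrow> (real vec \<times> (nat \<Rightarrow> real vec)) set
   \<Rightarrow> (nat \<Rightarrow> real vec \<times> real vec \<Rightarrow> real) \<Rightarrow> (real vec \<times> (nat \<Rightarrow> real vec) \<times> real) set" where
  "feasible_N m n F G g = {(x, y, w). x \<in> carrier_vec (n 0) \<and> y \<in> strategy_tuples m n \<and>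
     (x, y) \<in> G \<and> (x, y) \<in> F_hat m n F \<and>
     (\<forall>y'\<in>snd ` (F_hat m n F \<inter> G). w \<le> total_cost m g x y')}"

definition objective_N ::
  "nat \<Rightarrow> (nat \<Rightarrow> real vec \<times> real vec \<Rightarrow> real) \<Rightarrow> real vec \<times> (nat \<Rightarrow> real vec) \<times> real \<Rightarrow> real" where
  "objective_N m g = (\<lambda>(x, y, w). total_cost m g x y - w)"

definition delta_N ::
  "nat \<Rightarrow> (nat \<Rightarrow> nat) \<Rightarrow> (nat \<Rightarrow> (real vec \<times> real vec) set) \<Rightarrow> (real vec \<times> (nat \<Rightarrow> real vec)) set
   \<Rightarrow> (nat \<Rightarrow> real vec \<times> real vec \<Rightarrow> real) \<Rightarrow> ereal" where
  "delta_N m n F G g = opt_value (feasible_N m n F G g) (objective_N m g)"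

end

theory Submission
  imports Defs
begin

text \<open>
  A feasible triple \<open>(x, y, w)\<close> satisfies in particular the constraint indexed by \<open>y' = y\<close>, so the
  objective, which is the slack \<open>\<Sum>\<^sub>i g\<^sub>i(x, y\<^sub>i) - w\<close> of that constraint, is never negative. The slack vanishes
  exactly when \<open>w\<close> is the cost of \<open>y\<close>, and the remaining constraints then say that this cost is at
  most the cost of every \<open>y'\<close>, which is the equilibrium condition. Since \<open>0\<close> is a lower bound of
  the objective, the feasible points of objective value \<open>0\<close> are precisely the solutions of a problem
  whose optimal value is \<open>0\<close>. Both observations are combined in the theorem; the witness for \<open>w\<close> is
  the equilibrium cost.
\<close>

lemma objective_N_nonneg:
  assumes "z \<in> feasible_N m n F G g"
  shows "0 \<le> objective_N m g z"
proof -
  obtain x y w where z: "z = (x, y, w)"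
    by (cases z)
  with assms have "(x, y) \<in> F_hat m n F \<inter> G"
    and le: "\<forall>y'\<in>snd ` (F_hat m n F \<inter> G). w \<le> total_cost m g x y'"
    by (auto simp: feasible_N_def)
  then have "y \<in> snd ` (F_hat m n F \<inter> G)"
    by force
  with le have "w \<le> total_cost m g x y"
    by blast
  with z show ?thesis
    by (simp add: objective_N_def)
qed

text \<open>
  A lower bound of the objective that is attained is the optimal value; conversely a solution
  attains the optimal value by definition.
\<close>

lemma solution_with_lower_bound_value_iff:
  assumes "\<And>z. z \<in> S \<Longrightarrow> c \<le> f z"
  shows "is_solution S f z \<and> opt_value S f = ereal c \<longleftrightarrow> z \<in> S \<and> f z = c"
proof
  assume "is_solution S f z \<and> opt_value S f = ereal c"
  then show "z \<in> S \<and> f z = c"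
    by (auto simp: is_solution_def)
next
  assume z: "z \<in> S \<and> f z = c"
  have "opt_value S f = ereal c"
    unfolding opt_value_def
  proof (rule antisym)
    show "(INF z\<in>S. ereal (f z)) \<le> ereal c"
      using z by (intro INF_lower2[of z]) auto
    show "ereal c \<le> (INF z\<in>S. ereal (f z))"
      using assms by (intro INF_greatest) auto
  qed
  with z show "is_solution S f z \<and> opt_value S f = ereal c"
    by (simp add: is_solution_def)
qed

text \<open>
  At objective value \<open>0\<close> the variable \<open>w\<close> can be eliminated: it equals the cost of \<open>y\<close>, and
  substituting this value turns the semi-infinite constraint into the equilibrium inequality.
\<close>

lemma NNE_iff_feasible_objective_zero:
  "NNE m n F G g (x, y) \<longleftrightarrow>
    (\<exists>w. (x, y, w) \<in> feasible_N m n F G g \<and> objective_N m g (x, y, w) = 0)"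
proof -
  have "(x, y) \<in> F_hat m n F \<inter> G \<Longrightarrow> x \<in> carrier_vec (n 0) \<and> y \<in> strategy_tuples m n"
    by (simp add: F_hat_def)
  then have "NNE m n F G g (x, y) \<longleftrightarrow> (x, y, total_cost m g x y) \<in> feasible_N m n F G g"
    by (auto simp: NNE_def feasible_N_def case_prod_unfold)
  moreover have "objective_N m g (x, y, w) = 0 \<longleftrightarrow> w = total_cost m g x y" for w
    by (auto simp: objective_N_def)
  ultimately show ?thesis
    by simp
qed

theorem proposition3:
  fixes m :: nat and n :: "nat \<Rightarrow> nat"
    and F D :: "nat \<Rightarrow> (real vec \<times> real vec) set"
    and G :: "(real vec \<times> (nat \<Rightarrow> real vec)) set"
    and g :: "nat \<Rightarrow> real vec \<times> real vec \<Rightarrow> real"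
    and xs :: "real vec" and ys :: "nat \<Rightarrow> real vec"
  assumes "m \<ge> 1"
    and "G \<subseteq> carrier_vec (n 0) \<times> strategy_tuples m n" and "G \<noteq> {}"
    and "\<And>i. i \<in> {1..m} \<Longrightarrow> F i \<subseteq> carrier_vec (n 0) \<times> carrier_vec (n i)"
    and "\<And>i. i \<in> {1..m} \<Longrightarrow> D i \<subseteq> carrier_vec (n 0) \<times> carrier_vec (n i)"
    and "\<And>i. i \<in> {1..m} \<Longrightarrow> F i \<subseteq> D i"
    and "\<And>i x y'. i \<in> {1..m} \<Longrightarrow> x \<in> fst ` (F_hat m n F \<inter> G) \<Longrightarrow> y' \<in> snd ` (F_hat m n F \<inter> G)
           \<Longrightarrow> (x, y' i) \<in> D i"
    and "\<And>i. i \<in> {1..m} \<Longrightarrow> g i \<in> D i \<rightarrow>\<^sub>E UNIV"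
    and "\<And>x. x \<in> fst ` (F_hat m n F \<inter> G) \<Longrightarrow> g_N m n F G g x > -\<infinity>"
  shows "NNE m n F G g (xs, ys) \<longleftrightarrow>
    (\<exists>ws::real. is_solution (feasible_N m n F G g) (objective_N m g) (xs, ys, ws) \<and>
       delta_N m n F G g = 0)"
  unfolding NNE_iff_feasible_objective_zero delta_N_def
  using solution_with_lower_bound_value_iff
    [where S = "feasible_N m n F G g" and f = "objective_N m g"
      and c = 0, OF objective_N_nonneg]
  by (simp only: zero_ereal_def)

end
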